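(* Let $\mathcal{P}\subset\mathbb{R}^3$ be a point cloud and let $z_{\min},z_{\max}\in\mathbb{R}$ satisfy $z_{\min}\le z\le z_{\max}$ for all $(x,y,z)\in\mathcal{P}$. Let $f_w$ be the weighted quasi interpolant spline approximation to $\mathcal{P}$ of bi-degree $(p_x,p_y)$ over a $(p_x+1)$-regular knot vector $\mathbf{x}=[x_1,\dots,x_{n_x+p_x+1}]$ and a $(p_y+1)$-regular knot vector $\mathbf{y}=[y_1,\dots,y_{n_y+p_y+1}]$, with respect to a family of weight functions $w_{\mathbf{u}}:\mathbb{R}^2\to[0,+\infty)$, $\mathbf{u}\in\mathbb{R}^2$. Then for every $\mu$ with $p_x+1\le\mu\le n_x$ and every $\nu$ with $p_y+1\le\nu\le n_y$ there exist $\alpha(\mu,\nu),\beta(\mu,\nu)\in[z_{\min},z_{\max}]$ such that $$\alpha(\mu,\nu)\le f_w(x,y)\le\beta(\mu,\nu)\quad\text{for all }x\in[x_\mu,x_{\mu+1}),\ y\in[y_\nu,y_{\nu+1}).$$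
   Context: A point cloud is a finite nonempty set of points. B-splines. For a non-decreasing local knot vector $\mathbf{t}=[t_1,\dots,t_{p+2}]$, the B-spline $B[\mathbf{t}]:\mathbb{R}\to\mathbb{R}$ of degree $p$ is defined recursively by $$B[\mathbf{t}](x)=\frac{x-t_1}{t_{p+1}-t_1}B[t_1,\dots,t_{p+1}](x)+\frac{t_{p+2}-x}{t_{p+2}-t_2}B[t_2,\dots,t_{p+2}](x),$$ with $B[t_i,t_{i+1}](x)=1$ if $x\in[t_i,t_{i+1})$ and $0$ otherwise; terms with zero denominator are taken to be $0$ (convention $0/0=0$). For a global non-decreasing knot vector $\mathbf{t}=[t_1,\dots,t_{n+p+1}]$ put $\mathbf{t}^{(i)}=[t_i,\dots,t_{i+p+1}]$, $i=1,\dots,n$. A knot vector $\mathbf{t}=[t_1,\dots,t_{n+p+1}]$ is $(p+1)$-regular if $n\ge p+1$, $t_1=t_{p+1}$, $t_{n+1}=t_{n+p+1}$, and $t_j<t_{j+p+1}$ for $j=1,\dots,n$. Tensor product B-splines: $B[\mathbf{x}^{(i)},\mathbf{y}^{(j)}](x,y)=B[\mathbf{x}^{(i)}](x)\,B[\mathbf{y}^{(j)}](y)$. Weighted quasi interpolant spline approximation (wQISA). Let $p_x,p_y\ge1$ be integers. The wQISA to $\mathcal{P}$ is $$f_w(x,y)=\sum_{i=1}^{n_x}\sum_{j=1}^{n_y}\hat z_w\left(\xi_x^{(i)},\xi_y^{(j)}\right)B[\mathbf{x}^{(i)},\mathbf{y}^{(j)}](x,y),$$ where $\xi_x^{(i)}=(x_{i+1}+\dots+x_{i+p_x})/p_x$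 and $\xi_y^{(j)}=(y_{j+1}+\dots+y_{j+p_y})/p_y$ are the knot averages and $$\hat z_w(\mathbf{u})=\frac{\sum_{(x,y,z)\in\mathcal{P}}z\,w_{\mathbf{u}}(x,y)}{\sum_{(x,y,z)\in\mathcal{P}}w_{\mathbf{u}}(x,y)}.$$ It is assumed that the denominator is positive at each $\mathbf{u}=(\xi_x^{(i)},\xi_y^{(j)})$, so that $f_w$ is well defined. *)

theory Defs
  imports Complex_Main
begin

text \<open>
  A knot vector \<open>[t\<^sub>1, \<dots>, t\<^sub>m]\<close> is a function \<open>t :: nat \<Rightarrow> real\<close> of which only the values
  at the indices \<open>1, \<dots>, m\<close> are relevant.
\<close>

text \<open>
  The B-spline of degree \<open>p\<close> depends only on \<open>t 1, \<dots>, t (p + 2)\<close>. The convention that terms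
  with zero denominator vanish is that of HOL division, \<open>a / 0 = 0\<close>.
\<close>

primrec bspline :: "nat \<Rightarrow> (nat \<Rightarrow> real) \<Rightarrow> real \<Rightarrow> real" where
  "bspline 0 t x = (if x \<in> {t 1..<t 2} then 1 else 0)"
| "bspline (Suc p) t x =
     (x - t 1) / (t (Suc p + 1) - t 1) * bspline p t x
     + (t (Suc p + 2) - x) / (t (Suc p + 2) - t 2) * bspline p (\<lambda>k. t (k + 1)) x"

text \<open>\<open>local_knots t i\<close> is \<open>[t\<^sub>i, t\<^sub>i\<^sub>+\<^sub>1, \<dots>]\<close>, again indexed from 1 (for \<open>i \<ge> 1\<close>).\<close>

definition local_knots :: "(nat \<Rightarrow> real) \<Rightarrow> nat \<Rightarrow> nat \<Rightarrow> real" where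
  "local_knots t i = (\<lambda>k. t (i - 1 + k))"

text \<open>\<open>(p + 1)\<close>-regularity of the non-decreasing knot vector \<open>[t\<^sub>1, \<dots>, t\<^sub>n\<^sub>+\<^sub>p\<^sub>+\<^sub>1]\<close>.\<close>

definition regular_knots :: "nat \<Rightarrow> nat \<Rightarrow> (nat \<Rightarrow> real) \<Rightarrow> bool" where
  "regular_knots p n t \<longleftrightarrow>
     mono_on {1..n + p + 1} t \<and> p + 1 \<le> n \<and>
     t 1 = t (p + 1) \<and> t (n + 1) = t (n + p + 1) \<and>
     (\<forall>j\<in>{1..n}. t j < t (j + p + 1))"

definition tensor_bspline ::
    "nat \<Rightarrow> nat \<Rightarrow> (nat \<Rightarrow> real) \<Rightarrow> (nat \<Rightarrow> real) \<Rightarrow> real \<Rightarrow> real \<Rightarrow> real" where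
  "tensor_bspline px py s t x y = bspline px s x * bspline py t y"

definition knot_average :: "nat \<Rightarrow> (nat \<Rightarrow> real) \<Rightarrow> nat \<Rightarrow> real" where
  "knot_average p t i = (\<Sum>k = i + 1..i + p. t k) / real p"

definition weighted_z ::
    "(real \<times> real \<times> real) set \<Rightarrow> (real \<times> real \<Rightarrow> real \<times> real \<Rightarrow> real) \<Rightarrow> real \<times> real \<Rightarrow> real" where
  "weighted_z P w u = (\<Sum>(x, y, z)\<in>P. z * w u (x, y)) / (\<Sum>(x, y, z)\<in>P. w u (x, y))"

definition wQISA ::
    "(real \<times> real \<times> real) set \<Rightarrow> (real \<times> real \<Rightarrow> real \<times> real \<Rightarrow> real) \<Rightarrow>
     nat \<Rightarrow> nat \<Rightarrow> nat \<Rightarrow> nat \<Rightarrow> (nat \<Rightarrow> real) \<Rightarrow> (nat \<Rightarrow> real) \<Rightarrow> real \<Rightarrow> real \<Rightarrow> real" where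
  "wQISA P w px py nx ny xs ys x y =
     (\<Sum>i = 1..nx. \<Sum>j = 1..ny.
        weighted_z P w (knot_average px xs i, knot_average py ys j)
        * tensor_bspline px py (local_knots xs i) (local_knots ys j) x y)"

end

theory Submission
  imports Defs
begin

text \<open>
  The value \<open>wQISA P w px py nx ny xs ys x y\<close> is a weighted mean of weighted means of heights of
  the cloud. Each coefficient \<open>weighted_z P w u\<close> averages the heights with the nonnegative weights
  \<open>w u\<close>, so it lies between \<open>zmin\<close> and \<open>zmax\<close>. The tensor product B-splines that multiply the
  coefficients are nonnegative, and over the knot intervals in question they add up to one, so
  that the interval \<open>[zmin, zmax]\<close> is preserved a second time (the convex hull property). Hence
  \<open>\<alpha> = zmin\<close> and \<open>\<beta> = zmax\<close> serve for every pair \<open>(\<mu>, \<nu>)\<close>.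

  What carries the proof is the partition of unity \<open>sum_bspline_eq_1\<close>, by induction on the degree:
  in the recursion, each B-spline of the lower degree occurs in two neighbouring B-splines of the
  higher degree, with factors that add up to one. Only the two extreme lower-degree B-splines occur
  just once, and these vanish at the point considered because their support is elsewhere
  (\<open>bspline_eq_0\<close>).
\<close>

section \<open>B-splines over consecutive knots\<close>

text \<open>
  The recursion in terms of the global index: the two lower-degree splines of
  \<open>bspline (Suc p) (local_knots t i)\<close> start at the knots \<open>i\<close> and \<open>i + 1\<close>. At \<open>i = 0\<close> the
  truncated \<open>i - 1\<close> in \<^const>\<open>local_knots\<close> would break this.
\<close>

lemma bspline_Suc_local_knots:
  assumes "i \<ge> 1"
  shows "bspline (Suc p) (local_knots t i) x =
           (x - t i) / (t (i + p + 1) - t i) * bspline p (local_knots t i) x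
         + (t (i + p + 2) - x) / (t (i + p + 2) - t (i + 1)) * bspline p (local_knots t (i + 1)) x"
proof -
  obtain k where k: "i = Suc k"
    using assms by (cases i) auto
  show ?thesis
    by (simp add: local_knots_def k)
qed

lemma bspline_0_local_knots:
  assumes "i \<ge> 1"
  shows "bspline 0 (local_knots t i) x = (if t i \<le> x \<and> x < t (i + 1) then 1 else 0)"
proof -
  obtain k where k: "i = Suc k"
    using assms by (cases i) auto
  show ?thesis
    by (simp add: local_knots_def k numeral_2_eq_2)
qed

text \<open>
  From here on only the two forms in terms of the global index are used for rewriting: the defining
  equations would first rewrite \<^term>\<open>bspline p (local_knots t i) x\<close> into terms with shifted
  knot functions.
\<close>

declare bspline.simps [simp del]

lemma bspline_eq_0:
  assumes "mono_on {i..i + p + 1} t" and "i \<ge> 1" and "x < t i \<or> t (i + p + 1) \<le> x"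
  shows "bspline p (local_knots t i) x = 0"
  using assms
proof (induction p arbitrary: i)
  case 0
  then show ?case
    by (auto simp: bspline_0_local_knots)
next
  case (Suc p)
  have "t i \<le> t (i + 1)" and "t (i + p + 1) \<le> t (i + Suc p + 1)"
    using Suc.prems(1) by (auto intro: mono_onD)
  then have "x < t i \<or> t (i + p + 1) \<le> x" and "x < t (i + 1) \<or> t (i + 1 + p + 1) \<le> x"
    using Suc.prems(3) by auto
  moreover have "mono_on {i..i + p + 1} t" and "mono_on {i + 1..i + 1 + p + 1} t"
    using Suc.prems(1) by (auto intro: mono_on_subset)
  ultimately show ?case
    using Suc.IH[of i] Suc.IH[of "i + 1"] Suc.prems(2)
    by (simp add: bspline_Suc_local_knots)
qed

text \<open>
  The factors in the recursion can be negative, but only outside the support of the spline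
  that they multiply.
\<close>

lemma bspline_nonneg:
  assumes "mono_on {i..i + p + 1} t" and "i \<ge> 1"
  shows "0 \<le> bspline p (local_knots t i) x"
  using assms
proof (induction p arbitrary: i)
  case 0
  then show ?case
    by (simp add: bspline_0_local_knots)
next
  case (Suc p)
  have mono: "mono_on {i..i + p + 1} t" "mono_on {i + 1..i + 1 + p + 1} t"
    using Suc.prems(1) by (auto intro: mono_on_subset)
  have "0 \<le> (x - t i) / (t (i + p + 1) - t i) * bspline p (local_knots t i) x"
  proof (cases "t i \<le> x \<and> x < t (i + p + 1)")
    case True
    then show ?thesis
      using Suc.IH[OF mono(1) Suc.prems(2)] by simp
  next
    case False
    then show ?thesis
      using bspline_eq_0[OF mono(1) Suc.prems(2), of x] by auto
  qed
  moreover have "0 \<le> (t (i + p + 2) - x) / (t (i + p + 2) - t (i + 1))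
                       * bspline p (local_knots t (i + 1)) x"
  proof (cases "t (i + 1) \<le> x \<and> x < t (i + p + 2)")
    case True
    then show ?thesis
      using Suc.IH[OF mono(2)] by simp
  next
    case False
    then show ?thesis
      using bspline_eq_0[OF mono(2), of x] by auto
  qed
  ultimately show ?case
    using Suc.prems(2) by (simp only: bspline_Suc_local_knots add_nonneg_nonneg)
qed

section \<open>Partition of unity\<close>

text \<open>
  With \<open>a i = (x - t i) / (t (i + p + 1) - t i)\<close>, the sum for degree \<open>p + 1\<close> regroups into the sum
  of \<open>(a i + (1 - a i)) * bspline p (local_knots t i) x\<close>, up to the terms at \<open>i = 1\<close> and
  \<open>i = n + 1\<close>. The bounds on \<open>\<mu>\<close> put \<open>x\<close> beyond the support of the first of these splines and before
  that of the last one.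
\<close>

lemma sum_bspline_eq_1:
  assumes "mono_on {1..n + p + 1} t" and "\<mu> \<in> {p + 1..n}" and "t \<mu> \<le> x" and "x < t (\<mu> + 1)"
  shows "(\<Sum>i = 1..n. bspline p (local_knots t i) x) = 1"
  using assms
proof (induction p)
  case 0
  have "t i \<le> x \<and> x < t (i + 1) \<longleftrightarrow> i = \<mu>" if i: "i \<in> {1..n}" for i
  proof (cases i \<mu> rule: linorder_cases)
    case less
    then have "t (i + 1) \<le> t \<mu>"
      using 0 i by (intro mono_onD[OF 0(1)]) auto
    then show ?thesis
      using 0 less by auto
  next
    case equal
    then show ?thesis
      using 0 by simp
  next
    case greater
    then have "t (\<mu> + 1) \<le> t i"
      using 0 i by (intro mono_onD[OF 0(1)]) auto
    then show ?thesis
      using 0 greater by auto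
  qed
  then have "(\<Sum>i = 1..n. bspline 0 (local_knots t i) x) = (\<Sum>i = 1..n. if i = \<mu> then 1 else 0)"
    by (intro sum.cong) (auto simp: bspline_0_local_knots)
  then show ?case
    using 0 by simp
next
  case (Suc p)
  let ?N = "\<lambda>i. bspline p (local_knots t i) x"
  define a where "a i = (x - t i) / (t (i + p + 1) - t i)" for i
  define b where "b i = (t (i + p + 1) - x) / (t (i + p + 1) - t i)" for i
  have mono: "mono_on {i..i + p + 1} t" if "i \<in> {1..n + 1}" for i
    using that by (intro mono_on_subset[OF Suc.prems(1)]) auto
  have first: "?N 1 = 0"
  proof -
    have "t (1 + p + 1) \<le> t \<mu>"
      using Suc.prems(2) by (intro mono_onD[OF Suc.prems(1)]) auto
    then show ?thesis
      using Suc.prems(3) by (intro bspline_eq_0 mono) auto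
  qed
  have last: "?N (n + 1) = 0"
  proof -
    have "t (\<mu> + 1) \<le> t (n + 1)"
      using Suc.prems(2) by (intro mono_onD[OF Suc.prems(1)]) auto
    then show ?thesis
      using Suc.prems(4) by (intro bspline_eq_0 mono) auto
  qed
  have ab: "a i * ?N i + b i * ?N i = ?N i" if i: "i \<in> {1..n}" for i
  proof (cases "t i = t (i + p + 1)")
    case True
    \<comment> \<open>Here \<open>a i\<close> and \<open>b i\<close> are both zero, but the support of the spline is empty.\<close>
    then have "?N i = 0"
      using i by (intro bspline_eq_0 mono) auto
    then show ?thesis
      by simp
  next
    case False
    then have "a i + b i = 1"
      by (simp add: a_def b_def add_divide_distrib[symmetric])
    then show ?thesis
      by (simp flip: distrib_right)
  qed
  have "(\<Sum>i = 1..n. bspline (Suc p) (local_knots t i) x)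
      = (\<Sum>i = 1..n. a i * ?N i + b (i + 1) * ?N (i + 1))"
    by (intro sum.cong) (auto simp: bspline_Suc_local_knots a_def b_def)
  also have "\<dots> = (\<Sum>i = 1..n. a i * ?N i) + (\<Sum>i = 1..n. b (i + 1) * ?N (i + 1))"
    by (rule sum.distrib)
  also have "(\<Sum>i = 1..n. b (i + 1) * ?N (i + 1)) = (\<Sum>i = 1..n. b i * ?N i)"
  proof -
    have "(\<Sum>i = 1..n. b (i + 1) * ?N (i + 1)) - (\<Sum>i = 1..n. b i * ?N i)
        = b (n + 1) * ?N (n + 1) - b 1 * ?N 1"
      unfolding sum_subtractf[symmetric] using sum_Suc_diff[of 1 n "\<lambda>i. b i * ?N i"]
      by simp
    then show ?thesis
      using first last by simp
  qed
  also have "(\<Sum>i = 1..n. a i * ?N i) + (\<Sum>i = 1..n. b i * ?N i) = (\<Sum>i = 1..n. ?N i)"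
    unfolding sum.distrib[symmetric] by (intro sum.cong ab refl)
  also have "\<dots> = 1"
    using Suc.prems by (intro Suc.IH) (auto intro: mono_on_subset)
  finally show ?case .
qed

section \<open>Weighted means\<close>

text \<open>
  Serves for both averaging steps: over the points of the cloud, and over the index pairs of the
  tensor product B-splines, where the total weight is one.
\<close>

lemma weighted_mean_bounds:
  fixes f g :: "'a \<Rightarrow> real"
  assumes g: "\<And>a. a \<in> A \<Longrightarrow> 0 \<le> g a" and pos: "0 < (\<Sum>a\<in>A. g a)"
    and f: "\<And>a. a \<in> A \<Longrightarrow> m \<le> f a \<and> f a \<le> M"
  shows "(\<Sum>a\<in>A. f a * g a) / (\<Sum>a\<in>A. g a) \<in> {m..M}"
proof -
  have "m * (\<Sum>a\<in>A. g a) \<le> (\<Sum>a\<in>A. f a * g a)" and "(\<Sum>a\<in>A. f a * g a) \<le> M * (\<Sum>a\<in>A. g a)"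
    unfolding sum_distrib_left using f g by (auto intro!: sum_mono mult_right_mono)
  then show ?thesis
    using pos by (simp add: pos_le_divide_eq pos_divide_le_eq)
qed

lemma weighted_z_bounds:
  assumes "\<And>x y z. (x, y, z) \<in> P \<Longrightarrow> zmin \<le> z \<and> z \<le> zmax"
    and "\<And>v. 0 \<le> w u v" and "0 < (\<Sum>(x, y, z)\<in>P. w u (x, y))"
  shows "weighted_z P w u \<in> {zmin..zmax}"
  using weighted_mean_bounds[of P "\<lambda>(x, y, z). w u (x, y)" zmin "\<lambda>(x, y, z). z" zmax] assms
  unfolding weighted_z_def by (auto simp: case_prod_unfold)

text \<open>
  The partition of unity of the tensor products follows from those in each variable, since the
  sum over all index pairs is the product of the two sums.
\<close>

lemma wQISA_bounds:
  assumes knots: "mono_on {1..nx + px + 1} xs" "mono_on {1..ny + py + 1} ys"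
    and z: "\<And>i j. i \<in> {1..nx} \<Longrightarrow> j \<in> {1..ny} \<Longrightarrow>
              weighted_z P w (knot_average px xs i, knot_average py ys j) \<in> {zmin..zmax}"
    and x: "\<mu> \<in> {px + 1..nx}" "x \<in> {xs \<mu>..<xs (\<mu> + 1)}"
    and y: "\<nu> \<in> {py + 1..ny}" "y \<in> {ys \<nu>..<ys (\<nu> + 1)}"
  shows "wQISA P w px py nx ny xs ys x y \<in> {zmin..zmax}"
proof -
  let ?I = "{1..nx} \<times> {1..ny}"
  define c where "c = (\<lambda>(i, j). weighted_z P w (knot_average px xs i, knot_average py ys j))"
  define B where "B = (\<lambda>(i, j). tensor_bspline px py (local_knots xs i) (local_knots ys j) x y)"
  have nonneg: "0 \<le> B q" if "q \<in> ?I" for q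
    using that unfolding B_def tensor_bspline_def
    by (auto intro!: mult_nonneg_nonneg bspline_nonneg intro: mono_on_subset[OF knots(1)]
        mono_on_subset[OF knots(2)])
  have "(\<Sum>q\<in>?I. B q)
      = (\<Sum>i = 1..nx. bspline px (local_knots xs i) x) * (\<Sum>j = 1..ny. bspline py (local_knots ys j) y)"
    unfolding B_def tensor_bspline_def sum_product sum.cartesian_product ..
  also have "\<dots> = 1"
    using sum_bspline_eq_1[OF knots(1) x(1)] sum_bspline_eq_1[OF knots(2) y(1)] x(2) y(2) by simp
  finally have one: "(\<Sum>q\<in>?I. B q) = 1" .
  have c: "zmin \<le> c q \<and> c q \<le> zmax" if "q \<in> ?I" for q
    using that z unfolding c_def by auto
  have "wQISA P w px py nx ny xs ys x y = (\<Sum>q\<in>?I. c q * B q)"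
    unfolding wQISA_def B_def c_def sum.cartesian_product by (simp add: case_prod_unfold)
  then show ?thesis
    using weighted_mean_bounds[of ?I B zmin c zmax] nonneg c one by simp
qed

theorem corollary2p2:
  fixes P :: "(real \<times> real \<times> real) set"
    and w :: "real \<times> real \<Rightarrow> real \<times> real \<Rightarrow> real"
    and px py nx ny :: nat
    and xs ys :: "nat \<Rightarrow> real"
    and zmin zmax :: real
  assumes "finite P" and "P \<noteq> {}"
    and "\<And>x y z. (x, y, z) \<in> P \<Longrightarrow> zmin \<le> z \<and> z \<le> zmax"
    and "px \<ge> 1" and "py \<ge> 1"
    and "regular_knots px nx xs" and "regular_knots py ny ys"
    and "\<And>u v. 0 \<le> w u v"
    and "\<And>i j. i \<in> {1..nx} \<Longrightarrow> j \<in> {1..ny} \<Longrightarrow>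
           0 < (\<Sum>(x, y, z)\<in>P. w (knot_average px xs i, knot_average py ys j) (x, y))"
  shows "\<forall>\<mu>\<in>{px + 1..nx}. \<forall>\<nu>\<in>{py + 1..ny}.
           \<exists>\<alpha>\<in>{zmin..zmax}. \<exists>\<beta>\<in>{zmin..zmax}.
             \<forall>x\<in>{xs \<mu>..<xs (\<mu> + 1)}. \<forall>y\<in>{ys \<nu>..<ys (\<nu> + 1)}.
               \<alpha> \<le> wQISA P w px py nx ny xs ys x y \<and> wQISA P w px py nx ny xs ys x y \<le> \<beta>"
proof -
  have le: "zmin \<le> zmax"
    using assms(2,3) by fastforce
  have knots: "mono_on {1..nx + px + 1} xs" "mono_on {1..ny + py + 1} ys"
    using assms(6,7) by (auto simp: regular_knots_def)
  have "weighted_z P w (knot_average px xs i, knot_average py ys j) \<in> {zmin..zmax}"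
    if "i \<in> {1..nx}" "j \<in> {1..ny}" for i j
    using assms(3,8) assms(9)[OF that] by (intro weighted_z_bounds) auto
  note bounds = wQISA_bounds[OF knots this]
  have "\<forall>x\<in>{xs \<mu>..<xs (\<mu> + 1)}. \<forall>y\<in>{ys \<nu>..<ys (\<nu> + 1)}.
          zmin \<le> wQISA P w px py nx ny xs ys x y \<and> wQISA P w px py nx ny xs ys x y \<le> zmax"
    if "\<mu> \<in> {px + 1..nx}" "\<nu> \<in> {py + 1..ny}" for \<mu> \<nu>
    using bounds that by simp
  moreover have "zmin \<in> {zmin..zmax}" "zmax \<in> {zmin..zmax}"
    using le by auto
  ultimately show ?thesis
    by blast
qed

end
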